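(* Let $\Psi$ be a convex function on $\mathbb{D}$ with $\Psi(0)=0$, and suppose that for some $\delta$ $$ \operatorname{Re}\left(\exp\int_0^z\frac{\Psi(t)}{t}\,dt\right)\geq\delta>0\quad\text{for all } z\in\mathbb{D}. $$ Then $\mathcal{F}(\Psi)\subset\mathcal{G}_0$. Moreover, for every $f\in\mathcal{F}(\Psi)$ the semigroup $\{u(t,\cdot)\}_{t\geq0}$ generated by $f$ satisfies $$ |u(t,z)|\leq e^{-t\delta}|z|\quad\text{for all } t\geq0,\ z\in\mathbb{D}. $$
   Context: $\mathbb{D}=\{z\in\mathbb{C}:|z|<1\}$. $\mathcal{A}$ is the class of functions $f$ holomorphic in $\mathbb{D}$ with $f(0)=0$, $f'(0)=1$. A convex function is a univalent holomorphic function on $\mathbb{D}$ whose image is a convex set. $g\prec h$ (subordination) means $g=h\circ\omega$ for some holomorphic $\omega:\mathbb{D}\to\mathbb{D}$ with $\omega(0)=0$. For univalent $\Psi$ with $\Psi(0)=0$, $$\mathcal{F}(\Psi)=\left\{f\in\mathcal{A}:\frac{zf'(z)}{f(z)}-1\prec\Psi(z)\right\}.$$ $\mathcal{G}_0=\{f\in\mathcal{A}: f(z)=zp(z),\ \operatorname{Re}p(z)>0 \text{ for } z\in\mathbb{D}\}$; its elements are infinitesimal generators: the semigroup generated by $f\in\mathcal{G}_0$ is the family $\{u(t,\cdot)\}_{t\ge0}$ of holomorphic self-maps of $\mathbb{D}$ given by the unique solution of $\frac{\partial u(t,z)}{\partial t}+f(u(t,z))=0$, $u(0,z)=z$. *)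

theory Defs
  imports "HOL-Complex_Analysis.Complex_Analysis"
begin

abbreviation unit_disc :: "complex set" (\<open>\<D>\<close>)
  where "\<D> \<equiv> ball 0 1"

definition univalent :: "(complex \<Rightarrow> complex) \<Rightarrow> bool" where
  "univalent h \<longleftrightarrow> h holomorphic_on \<D> \<and> inj_on h \<D>"

definition convex_function :: "(complex \<Rightarrow> complex) \<Rightarrow> bool" where
  "convex_function h \<longleftrightarrow> univalent h \<and> convex (h ` \<D>)"

definition class_A :: "(complex \<Rightarrow> complex) set" (\<open>\<A>\<close>) where
  "\<A> = {f. f holomorphic_on \<D> \<and> f 0 = 0 \<and> deriv f 0 = 1}"

definition subordinate :: "(complex \<Rightarrow> complex) \<Rightarrow> (complex \<Rightarrow> complex) \<Rightarrow> bool"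
    (infix \<open>\<prec>\<^sub>D\<close> 50) where
  "g \<prec>\<^sub>D h \<longleftrightarrow>
     (\<exists>\<omega>. \<omega> holomorphic_on \<D> \<and> \<omega> ` \<D> \<subseteq> \<D> \<and> \<omega> 0 = 0 \<and> (\<forall>z\<in>\<D>. g z = h (\<omega> z)))"

text \<open>
  For \<open>f\<close> in the class \<open>\<A>\<close>, the function \<open>z f'(z) / f(z) - 1\<close> has a removable singularity at
  the origin, with value \<open>0\<close> there. As division by zero is total, this value is given explicitly,
  and the nonvanishing of \<open>f\<close> on the punctured disc, without which the quotient has poles, is
  stated in the definition of \<open>class_F\<close>.
\<close>

definition log_deriv_shift :: "(complex \<Rightarrow> complex) \<Rightarrow> complex \<Rightarrow> complex" where
  "log_deriv_shift f z = (if z = 0 then 0 else z * deriv f z / f z - 1)"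

definition class_F :: "(complex \<Rightarrow> complex) \<Rightarrow> (complex \<Rightarrow> complex) set" (\<open>\<F>\<close>) where
  "\<F> \<Psi> = {f \<in> \<A>. (\<forall>z\<in>\<D> - {0}. f z \<noteq> 0) \<and> log_deriv_shift f \<prec>\<^sub>D \<Psi>}"

text \<open>
  Holomorphy of \<open>p\<close> matters only at the origin, where \<open>f z = z * p z\<close> does not determine \<open>p\<close>.
\<close>

definition class_G0 :: "(complex \<Rightarrow> complex) set" (\<open>\<G>\<^sub>0\<close>) where
  "\<G>\<^sub>0 = {f \<in> \<A>. \<exists>p. p holomorphic_on \<D> \<and> (\<forall>z\<in>\<D>. f z = z * p z \<and> Re (p z) > 0)}"

text \<open>
  The derivative in time is one-sided at \<open>t = 0\<close>. On the disc and for \<open>t \<ge> 0\<close> these conditions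
  determine \<open>u\<close>; elsewhere its values are irrelevant.
\<close>

definition generated_semigroup ::
    "(complex \<Rightarrow> complex) \<Rightarrow> (real \<Rightarrow> complex \<Rightarrow> complex) \<Rightarrow> bool" where
  "generated_semigroup f u \<longleftrightarrow>
     (\<forall>t\<ge>0. u t holomorphic_on \<D> \<and> u t ` \<D> \<subseteq> \<D>) \<and>
     (\<forall>z\<in>\<D>. u 0 z = z \<and>
        (\<forall>t\<ge>0. ((\<lambda>s. u s z) has_vector_derivative - f (u t z)) (at t within {0..})))"

end

theory Submission
  imports Defs
begin

text \<open>
  Write \<open>f z = z * exp (G z)\<close> and let \<open>Q z\<close> be the integral of \<open>\<Psi> t / t\<close> from \<open>0\<close> to \<open>z\<close>. Then
  \<open>z * G' z = z * f' z / f z - 1 = \<Psi> (\<omega> z)\<close> and \<open>z * Q' z = \<Psi> z\<close>. Both claims follow from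
  \<open>Re (exp (G z)) \<ge> \<delta>\<close>: this puts \<open>f\<close> in the class \<open>\<G>\<^sub>0\<close>, and along the flow it forces
  \<open>|u|\<^sup>2\<close> to decay at least at the rate \<open>2 * \<delta>\<close> (\<open>semigroup_exponential_decay\<close>).

  The bound \<open>Re (exp w) \<ge> \<delta>\<close> holds on the image of \<open>Q\<close> and has to be transferred to the image of
  \<open>G\<close>. The classical route shows that \<open>G\<close> is subordinate to \<open>Q\<close>. A weaker fact suffices here: the
  part of \<open>{w. Re (exp w) \<ge> \<delta>}\<close> in the strip \<open>|Im w| \<le> pi / 2\<close> is closed and convex
  (\<open>convex_closed_exp_halfplane_strip\<close>), so it is enough that \<open>G\<close> takes values in every closed
  half-plane that contains the image of \<open>Q\<close>. That is a one-directional comparison, proved by a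
  maximum argument in \<open>direction_bound_on_ray\<close>, in the spirit of Jack's lemma: at a point \<open>z\<close> of a
  circle where the component of \<open>G\<close> in direction \<open>e\<close> is maximal, \<open>\<Psi> (\<omega> z)\<close> is a real multiple of
  \<open>e\<close>, and it lies no further out in this direction than the value of \<open>\<Psi>\<close> at the point of the
  same circle that \<open>\<Psi>\<close> sends to the ray in direction \<open>e\<close>. So the maximal component of \<open>G\<close> grows
  no faster with the radius than the component of \<open>Q\<close> along the preimage of the ray. Comparing
  positions on a ray in this way is an application of the Schwarz lemma
  (\<open>starlike_image_norm_less\<close>), which works because the image of \<open>\<Psi>\<close>, being convex, contains the
  segment from the origin to each of its points.
\<close>

section \<open>Univalent maps onto starlike domains\<close>

locale starlike_univalent =
  fixes h :: "complex \<Rightarrow> complex"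
  assumes hol: "h holomorphic_on \<D>" and inj: "inj_on h \<D>" and h0: "h 0 = 0"
    and star: "\<And>z t. z \<in> \<D> \<Longrightarrow> 0 \<le> t \<Longrightarrow> t \<le> 1 \<Longrightarrow> of_real t * h z \<in> h ` \<D>"
begin

text \<open>
  Shrinking the image, \<open>z \<mapsto> h\<inverse> (t * h z)\<close>, is a self-map of the disc fixing the origin, so the
  Schwarz lemma gives \<open>\<le>\<close>. Equality would make this map a rotation, but its derivative at the
  origin is \<open>t < 1\<close>. Consequently \<open>|h\<inverse>|\<close> is strictly increasing along each ray from the origin.
\<close>
lemma starlike_image_norm_less:
  assumes z: "z \<in> \<D>" "z \<noteq> 0" and w: "w \<in> \<D>"
    and t: "0 \<le> t" "t < 1" and eq: "h w = of_real t * h z"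
  shows "norm w < norm z"
proof -
  obtain g where g: "g holomorphic_on h ` \<D>"
    and g_inv: "\<And>z. z \<in> \<D> \<Longrightarrow> g (h z) = z"
    using holomorphic_has_inverse[OF hol open_ball inj] by metis
  define \<phi> where "\<phi> z = g (of_real t * h z)" for z
  have sub: "of_real t * h z \<in> h ` \<D>" if "z \<in> \<D>" for z
    using star[OF that] t by auto
  have h\<phi>: "h (\<phi> z) = of_real t * h z" "\<phi> z \<in> \<D>" if "z \<in> \<D>" for z
    using sub[OF that] g_inv unfolding \<phi>_def by fastforce+
  have hol\<phi>: "\<phi> holomorphic_on \<D>"
  proof -
    have "(\<lambda>z. of_real t * h z) holomorphic_on \<D>" by (intro holomorphic_intros hol)
    moreover have "(\<lambda>z. of_real t * h z) ` \<D> \<subseteq> h ` \<D>" using sub by blast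
    ultimately show ?thesis
      using holomorphic_on_compose_gen[OF _ g] by (simp add: \<phi>_def[abs_def] o_def)
  qed
  have \<phi>0: "\<phi> 0 = 0"
    using g_inv[of 0] h0 by (simp add: \<phi>_def)
  have self: "norm (\<phi> z) < 1" if "norm z < 1" for z
    using h\<phi>(2)[of z] that by simp
  have "w = \<phi> z"
    using g_inv[OF w] eq by (simp add: \<phi>_def)
  moreover have "norm (\<phi> z) \<noteq> norm z"
  proof
    assume "norm (\<phi> z) = norm z"
    then obtain a where a: "\<And>z. norm z < 1 \<Longrightarrow> \<phi> z = a * z" "norm a = 1"
      using Schwarz_Lemma(3)[OF hol\<phi> \<phi>0 self, of 0] z by auto
    \<comment> \<open>Differentiate \<open>h (a * z) = t * h z\<close> at the origin; this gives \<open>a = t\<close>, against \<open>|a| = 1\<close>.\<close>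
    have d: "(h has_field_derivative deriv h u) (at u)" if "u \<in> \<D>" for u
      using holomorphic_derivI[OF hol open_ball that] .
    have "((\<lambda>z. h (a * z)) has_field_derivative (deriv h 0 * a)) (at 0)"
      using d[of 0] by (auto intro!: derivative_eq_intros DERIV_chain2[of h "deriv h 0" "\<lambda>z. a * z" 0])
    then have "((\<lambda>z. of_real t * h z) has_field_derivative (deriv h 0 * a)) (at 0)"
    proof (rule has_field_derivative_transform_within[where d = 1])
      fix u :: complex assume "dist u 0 < 1"
      then show "h (a * u) = of_real t * h u"
        using h\<phi>(1)[of u] a(1)[of u] by (simp add: dist_norm)
    qed simp_all
    moreover have "((\<lambda>z. of_real t * h z) has_field_derivative (of_real t * deriv h 0)) (at 0)"
      using d[of 0] by (auto intro!: derivative_eq_intros)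
    ultimately have "deriv h 0 * a = of_real t * deriv h 0"
      by (rule DERIV_unique)
    moreover have "deriv h 0 \<noteq> 0"
      using holomorphic_injective_imp_regular[OF hol open_ball inj, of 0] by simp
    ultimately have "a = of_real t"
      by simp
    with a(2) t show False by simp
  qed
  moreover have "norm (\<phi> z) \<le> norm z"
    using Schwarz_Lemma(1)[OF hol\<phi> \<phi>0 self, of z] z by auto
  ultimately show ?thesis by simp
qed

text \<open>
  Follow the ray until it leaves the compact set \<open>h ` cball 0 r\<close>. The last point is taken on the
  circle, because points of the open disc have open image and the ray could be followed further.
\<close>
lemma circle_meets_ray:
  assumes r: "0 \<le> r" "r < 1" and e: "norm e = 1"
  obtains \<zeta> s where "norm \<zeta> = r" "0 \<le> s" "h \<zeta> = of_real s * e"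
proof -
  define A where "A = {s. 0 \<le> s \<and> of_real s * e \<in> h ` cball 0 r}"
  have sub: "cball 0 r \<subseteq> \<D>" using r by auto
  have comp: "compact (h ` cball 0 r)"
    using hol sub by (intro compact_continuous_image holomorphic_on_imp_continuous_on
        holomorphic_on_subset[OF hol]) auto
  have "closed A"
  proof -
    have "A = {0..} \<inter> (\<lambda>s. of_real s * e) -` (h ` cball 0 r)" by (auto simp: A_def)
    then show ?thesis
      using comp by (auto intro!: closed_Int closed_vimage continuous_intros simp: compact_imp_closed)
  qed
  moreover have "bounded A"
  proof -
    obtain B where B: "\<And>w. w \<in> h ` cball 0 r \<Longrightarrow> norm w \<le> B"
      using compact_imp_bounded[OF comp] by (auto simp: bounded_iff)
    have "norm s \<le> B" if "s \<in> A" for s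
      using that B[of "of_real s * e"] e by (auto simp: A_def norm_mult)
    then show ?thesis by (auto simp: bounded_iff)
  qed
  ultimately have "compact A" by (simp add: compact_eq_bounded_closed)
  moreover have "0 \<in> A" using h0 r by (force simp: A_def)
  ultimately obtain s where s: "s \<in> A" "\<And>x. x \<in> A \<Longrightarrow> x \<le> s"
    using compact_attains_sup[of A] by auto
  then obtain \<zeta> where \<zeta>: "norm \<zeta> \<le> r" "h \<zeta> = of_real s * e" "0 \<le> s"
    by (auto simp: A_def)
  have "norm \<zeta> = r"
  proof (rule ccontr)
    assume "norm \<zeta> \<noteq> r"
    with \<zeta> have less: "norm \<zeta> < r" by simp
    have "open (h ` ball 0 r)"
      using sub ball_subset_cball[of 0 r]
      by (intro open_mapping_thm3 holomorphic_on_subset[OF hol] inj_on_subset[OF inj]) auto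
    moreover have "h \<zeta> \<in> h ` ball 0 r" using less by auto
    ultimately obtain d where d: "d > 0" "ball (h \<zeta>) d \<subseteq> h ` ball 0 r"
      by (meson open_contains_ball)
    have "dist (h \<zeta>) (of_real (s + d/2) * e) = d / 2"
      using d(1) e by (simp add: \<zeta>(2) dist_norm ring_distribs norm_mult norm_divide)
    then have "of_real (s + d/2) * e \<in> h ` ball 0 r" using d by auto
    then have "s + d/2 \<in> A" using \<zeta>(3) d(1) by (auto simp: A_def intro!: image_eqI)
    with s(2) d(1) show False by fastforce
  qed
  with \<zeta> that show ?thesis by blast
qed

end

section \<open>A convex component of the set where Re exp is bounded below\<close>

text \<open>
  With \<open>w = x + i * y\<close> the second condition reads \<open>exp x * cos y \<ge> \<delta>\<close>. As \<open>\<delta> > 0\<close>, it excludes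
  \<open>|y| = pi / 2\<close>, so the closed strip may be used. Inside the strip it says that
  \<open>x \<ge> ln \<delta> - ln (cos y)\<close>, the epigraph of a convex function of \<open>y\<close>.
\<close>
lemma convex_closed_exp_halfplane_strip:
  assumes "\<delta> > 0"
  shows "convex {w. \<bar>Im w\<bar> \<le> pi / 2 \<and> \<delta> \<le> Re (exp w)}"
    and "closed {w. \<bar>Im w\<bar> \<le> pi / 2 \<and> \<delta> \<le> Re (exp w)}"
proof -
  let ?C = "{w. \<bar>Im w\<bar> \<le> pi / 2 \<and> \<delta> \<le> Re (exp w)}"
  let ?I = "{- (pi / 2)<..<pi / 2}"
  have cos_pos: "cos y > 0" if "y \<in> ?I" for y
    using that by (intro cos_gt_zero_pi) auto
  have epi: "w \<in> ?C \<longleftrightarrow> Im w \<in> ?I \<and> ln \<delta> + (- ln (cos (Im w))) \<le> Re w" for w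
  proof (cases "Im w \<in> ?I")
    case True
    have "\<delta> \<le> Re (exp w) \<longleftrightarrow> ln \<delta> \<le> ln (exp (Re w) * cos (Im w))"
      using assms cos_pos[OF True] by (simp add: Re_exp)
    also have "\<dots> \<longleftrightarrow> ln \<delta> + (- ln (cos (Im w))) \<le> Re w"
      using cos_pos[OF True] by (subst ln_mult) auto
    finally show ?thesis using True by auto
  next
    case False
    have "w \<notin> ?C"
    proof
      assume "w \<in> ?C"
      moreover from this False have "\<bar>Im w\<bar> = pi / 2" by auto
      from arg_cong[OF this, of cos] have "cos (Im w) = 0" by simp
      ultimately show False using assms by (simp add: Re_exp)
    qed
    with False show ?thesis by blast
  qed
  have cvx: "convex_on ?I (\<lambda>y. - ln (cos y))"
  proof (rule f''_ge0_imp_convex)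
    fix y assume "y \<in> ?I"
    then have "cos y > 0" by (rule cos_pos)
    then show "((\<lambda>y. - ln (cos y)) has_real_derivative tan y) (at y)"
      by (auto intro!: derivative_eq_intros simp: tan_def divide_simps)
    show "(tan has_real_derivative inverse ((cos y)\<^sup>2)) (at y)"
      using \<open>cos y > 0\<close> by (intro DERIV_tan) simp
  qed auto
  show "convex ?C"
  proof (rule convexI)
    fix w z :: complex and a b :: real
    assume w: "w \<in> ?C" and z: "z \<in> ?C" and ab: "0 \<le> a" "0 \<le> b" "a + b = 1"
    have I: "Im w \<in> ?I" "Im z \<in> ?I" using w z unfolding epi by auto
    have "a *\<^sub>R Im w + b *\<^sub>R Im z \<in> ?I"
      by (rule convexD[OF _ I ab]) simp
    moreover have "- ln (cos (a *\<^sub>R Im w + b *\<^sub>R Im z)) \<le> a * (- ln (cos (Im w))) + b * (- ln (cos (Im z)))"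
      using cvx I ab by (auto simp: convex_on_def)
    moreover have "a * (ln \<delta> + (- ln (cos (Im w)))) \<le> a * Re w"
      and "b * (ln \<delta> + (- ln (cos (Im z)))) \<le> b * Re z"
      using w z ab unfolding epi by (auto intro!: mult_left_mono)
    moreover have "ln \<delta> = a * ln \<delta> + b * ln \<delta>"
      using ab by (metis distrib_right mult_1)
    ultimately show "a *\<^sub>R w + b *\<^sub>R z \<in> ?C"
      unfolding epi by (simp add: algebra_simps)
  qed
  show "closed ?C"
    unfolding Collect_conj_eq
    by (intro closed_Int closed_Collect_le continuous_intros)
qed

section \<open>Subordination under the logarithmic integral\<close>

text \<open>
  With \<open>g = h \<circ> \<omega>\<close> subordinate to \<open>h\<close>, the functions \<open>G\<close> and \<open>Q\<close> are the integrals of \<open>g t / t\<close>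
  and \<open>h t / t\<close> from the origin. The Schwarz lemma for \<open>\<omega>\<close> gives the bound on its modulus.
\<close>
locale subordinate_integrals = starlike_univalent +
  fixes \<omega> G Q :: "complex \<Rightarrow> complex"
  assumes \<omega>: "\<And>z. z \<in> \<D> \<Longrightarrow> norm (\<omega> z) \<le> norm z"
    and G: "G holomorphic_on \<D>" "G 0 = 0" "\<And>z. z \<in> \<D> \<Longrightarrow> z * deriv G z = h (\<omega> z)"
    and Q: "Q holomorphic_on \<D>" "Q 0 = 0" "\<And>z. z \<in> \<D> \<Longrightarrow> z * deriv Q z = h z"
begin

text \<open>
  Let \<open>\<gamma> x = h\<inverse> (x * e)\<close> be the preimage of the ray in direction \<open>e\<close>. In the coordinates \<open>x\<close> and
  \<open>|c| = 1\<close> consider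
  \<open>H (x, c) = Re (cnj e * (G (c * \<gamma> x) - Q (\<gamma> x))) - \<epsilon> * x\<close>, which vanishes for \<open>x = 0\<close>.
  Suppose that it has a maximum at some \<open>x > 0\<close> and \<open>c\<close>, and put \<open>z = c * \<gamma> x\<close>. Stationarity in the
  angle of \<open>c\<close> makes \<open>cnj e * (z * G' z)\<close> real, that is, \<open>h (\<omega> z) = k * e\<close> with \<open>k\<close> real: both
  \<open>h (\<omega> z)\<close> and \<open>h (\<gamma> x) = x * e\<close> lie on one line through the origin. Since
  \<open>|\<omega> z| \<le> |z| = |\<gamma> x|\<close>, monotonicity of \<open>|h\<inverse>|\<close> on the ray gives \<open>k \<le> x\<close>. But the
  \<open>x\<close>-derivative of \<open>H\<close> is \<open>(k - x) * Re (\<gamma>' / \<gamma>) - \<epsilon>\<close>, where \<open>Re (\<gamma>' / \<gamma>) \<ge> 0\<close> because \<open>|\<gamma>|\<close>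
  increases; so it is negative, which contradicts maximality. Hence \<open>H \<le> 0\<close> for every \<open>\<epsilon> > 0\<close>.
\<close>
lemma direction_bound_on_ray:
  assumes e: "norm e = 1" and c: "norm c = 1"
    and \<zeta>: "\<zeta> \<in> \<D>" "0 \<le> s" "h \<zeta> = of_real s * e"
  shows "Re (cnj e * G (c * \<zeta>)) \<le> Re (cnj e * Q \<zeta>)"
proof (cases "s = 0")
  case True
  then have "\<zeta> = 0" using inj \<zeta> h0 by (auto simp: inj_on_def)
  then show ?thesis by (simp add: G Q)
next
  case False
  with \<zeta> have s: "s > 0" by simp
  have ee: "cnj e * e = 1" "e * cnj e = 1" "e \<noteq> 0"
    using e by (auto simp: complex_norm_square[symmetric] mult.commute)
  obtain g where g: "g holomorphic_on h ` \<D>"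
    and g_inv: "\<And>z. z \<in> \<D> \<Longrightarrow> g (h z) = z"
    using holomorphic_has_inverse[OF hol open_ball inj] by metis
  have opn: "open (h ` \<D>)" by (rule open_mapping_thm3[OF hol open_ball inj])
  define \<gamma> where "\<gamma> x = g (x * e)" for x
  have ray: "of_real x * e \<in> h ` \<D>" if "0 \<le> x" "x \<le> s" for x
    using star[OF \<zeta>(1), of "x / s"] that s \<zeta>(3) by simp
  have \<gamma>: "\<gamma> (of_real x) \<in> \<D>" "h (\<gamma> (of_real x)) = of_real x * e" if "0 \<le> x" "x \<le> s" for x
    using ray[OF that] g_inv unfolding \<gamma>_def by fastforce+
  have \<gamma>_nz: "\<gamma> (of_real x) \<noteq> 0" if "0 < x" "x \<le> s" for x
    using \<gamma>(2)[of x] that h0 ee by auto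
  have \<gamma>s: "\<gamma> (of_real s) = \<zeta>" using g_inv[OF \<zeta>(1)] \<zeta>(3) by (simp add: \<gamma>_def)
  have \<gamma>0: "\<gamma> 0 = 0" using g_inv[of 0] h0 by (simp add: \<gamma>_def)
  have cont_\<gamma>: "continuous_on {0..s} (\<lambda>x. \<gamma> (of_real x))"
    unfolding \<gamma>_def
    by (rule continuous_on_compose2[OF holomorphic_on_imp_continuous_on[OF g]])
      (use ray in \<open>auto intro!: continuous_intros\<close>)
  have d\<gamma>: "(\<gamma> has_field_derivative deriv g (of_real x * e) * e) (at (of_real x))"
    if "0 \<le> x" "x \<le> s" for x
    unfolding \<gamma>_def
    using holomorphic_derivI[OF g opn ray[OF that]]
    by (auto intro!: derivative_eq_intros DERIV_chain2[of g])
  have mono: "norm (\<gamma> (of_real x)) < norm (\<gamma> (of_real y))" if "0 \<le> x" "x < y" "y \<le> s" for x y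
  proof (rule starlike_image_norm_less[of _ _ "x / y"])
    show "h (\<gamma> (of_real x)) = of_real (x / y) * h (\<gamma> (of_real y))"
      using \<gamma>(2)[of x] \<gamma>(2)[of y] that by simp
  qed (use that \<gamma> \<gamma>_nz in auto)
  have dG: "(G has_field_derivative deriv G u) (at u)" if "u \<in> \<D>" for u
    using holomorphic_derivI[OF G(1) open_ball that] .
  have dQ: "(Q has_field_derivative deriv Q u) (at u)" if "u \<in> \<D>" for u
    using holomorphic_derivI[OF Q(1) open_ball that] .
  have rot: "c * \<gamma> (of_real x) \<in> \<D>" if "0 \<le> x" "x \<le> s" "norm c = 1" for c x
    using \<gamma>(1)[of x] that by (simp add: norm_mult)
  have Re_mult_of_real: "Re (of_real r * w) = r * Re w" for r :: real and w by simp
  have main: "Re (cnj e * (G (c * \<zeta>) - Q \<zeta>)) \<le> \<epsilon> * s" if \<epsilon>: "\<epsilon> > 0" for \<epsilon>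
  proof -
    define H where "H p = Re (cnj e * (G (snd p * \<gamma> (of_real (fst p))) - Q (\<gamma> (of_real (fst p)))))
        - \<epsilon> * fst p" for p
    define K where "K = {0..s} \<times> sphere (0::complex) 1"
    have cK: "continuous_on K H"
      unfolding H_def K_def
      by (intro continuous_intros continuous_on_compose2[OF holomorphic_on_imp_continuous_on[OF G(1)]]
          continuous_on_compose2[OF holomorphic_on_imp_continuous_on[OF Q(1)]]
          continuous_on_compose2[OF cont_\<gamma>]) (use rot \<gamma> in auto)
    have "compact K" "K \<noteq> {}"
      using s c by (auto simp: K_def intro!: compact_Times)
    then obtain p where p: "p \<in> K" "\<And>q. q \<in> K \<Longrightarrow> H q \<le> H p"
      using continuous_attains_sup[OF _ _ cK] by auto
    define x a where "x = fst p" and "a = snd p"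
    have x: "0 \<le> x" "x \<le> s" and a: "norm a = 1" and pxa: "p = (x, a)"
      using p(1) by (auto simp: K_def x_def a_def)
    have "x = 0"
    proof (rule ccontr)
      assume "x \<noteq> 0"
      with x have x0: "x > 0" by simp
      define z where "z = a * \<gamma> (of_real x)"
      define \<gamma>' where "\<gamma>' = deriv g (of_real x * e) * e"
      have z: "z \<in> \<D>" using rot x a by (simp add: z_def)
      define k where "k = Re (cnj e * h (\<omega> z))"
      have "((\<lambda>T. exp (\<i> * T) * z) has_field_derivative \<i> * z) (at (of_real 0))"
        by (auto intro!: derivative_eq_intros)
      then have "((\<lambda>T. G (exp (\<i> * T) * z)) has_field_derivative deriv G z * (\<i> * z)) (at (of_real 0))"
        by (rule DERIV_chain2[rotated]) (use dG[OF z] in simp)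
      then have "((\<lambda>T. cnj e * G (exp (\<i> * T) * z)) has_field_derivative
          cnj e * (deriv G z * (\<i> * z))) (at (of_real 0))"
        by (rule DERIV_cmult)
      then have "((\<lambda>T. Re (cnj e * G (exp (\<i> * of_real T) * z))) has_real_derivative
          Re (cnj e * (deriv G z * (\<i> * z)))) (at 0)"
        using has_vector_derivative_real_field has_field_derivative_Re by blast
      moreover have "Re (cnj e * G (exp (\<i> * of_real T) * z)) \<le>
          Re (cnj e * G (exp (\<i> * of_real 0) * z))" for T :: real
        using p(2)[of "(x, exp (\<i> * of_real T) * a)"] x a
        by (simp add: H_def K_def pxa z_def norm_mult algebra_simps)
      ultimately have "Re (cnj e * (deriv G z * (\<i> * z))) = 0"
        using DERIV_local_max[of _ _ 0 1] by simp
      moreover have "cnj e * (deriv G z * (\<i> * z)) = \<i> * (cnj e * h (\<omega> z))"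
        using G(3)[OF z] by (simp add: algebra_simps)
      ultimately have "Im (cnj e * h (\<omega> z)) = 0" by simp
      then have "cnj e * h (\<omega> z) = of_real k" by (simp add: k_def complex_eq_iff)
      then have hk: "h (\<omega> z) = of_real k * e"
        using ee by (metis mult.assoc mult.commute mult.right_neutral)
      have "k \<le> x"
      proof (rule ccontr)
        assume "\<not> k \<le> x"
        then have kx: "x < k" by simp
        have norm_z: "norm z = norm (\<gamma> (of_real x))" using a by (simp add: z_def norm_mult)
        have \<omega>z: "\<omega> z \<in> \<D>" using \<omega>[OF z] z by simp
        have "norm (\<gamma> (of_real x)) < norm (\<omega> z)"
        proof (rule starlike_image_norm_less[of _ _ "x / k"])
          show "h (\<gamma> (of_real x)) = of_real (x / k) * h (\<omega> z)"
            using \<gamma>(2)[OF x] hk kx x0 by simp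
          show "\<omega> z \<noteq> 0" using hk h0 kx x0 ee by auto
        qed (use \<omega>z \<gamma> x x0 kx in auto)
        with \<omega>[OF z] norm_z show False by simp
      qed
      \<comment> \<open>The chain rule along the ray, in which \<open>z * G' z = k * e\<close> and \<open>\<gamma> x * Q' (\<gamma> x) = x * e\<close>.\<close>
      have "((\<lambda>X. cnj e * (G (a * \<gamma> X) - Q (\<gamma> X))) has_field_derivative
          cnj e * (deriv G z * (a * \<gamma>') - deriv Q (\<gamma> (of_real x)) * \<gamma>')) (at (of_real x))"
        using dG[OF z] dQ[OF \<gamma>(1)[OF x]] d\<gamma>[OF x] unfolding \<gamma>'_def z_def
        by (intro DERIV_cmult DERIV_diff DERIV_chain2[of G] DERIV_chain2[of Q])
      then have "((\<lambda>X. Re (cnj e * (G (a * \<gamma> (of_real X)) - Q (\<gamma> (of_real X))))) has_real_derivative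
          Re (cnj e * (deriv G z * (a * \<gamma>') - deriv Q (\<gamma> (of_real x)) * \<gamma>'))) (at x)"
        using has_vector_derivative_real_field has_field_derivative_Re by blast
      moreover have "cnj e * (deriv G z * (a * \<gamma>') - deriv Q (\<gamma> (of_real x)) * \<gamma>')
          = of_real (k - x) * (\<gamma>' / \<gamma> (of_real x))"
      proof -
        have nz: "\<gamma> (of_real x) \<noteq> 0" using \<gamma>_nz x x0 by simp
        have "deriv G z * a * \<gamma> (of_real x) = of_real k * e"
          using G(3)[OF z] hk by (simp add: z_def mult_ac)
        then have 1: "deriv G z * a = of_real k * e / \<gamma> (of_real x)"
          using nz by (simp add: field_simps)
        have "deriv Q (\<gamma> (of_real x)) * \<gamma> (of_real x) = of_real x * e"
          using Q(3)[of "\<gamma> (of_real x)"] \<gamma>[OF x] by (simp add: mult_ac)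
        then have 2: "deriv Q (\<gamma> (of_real x)) = of_real x * e / \<gamma> (of_real x)"
          using nz by (simp add: field_simps)
        have "cnj e * (deriv G z * (a * \<gamma>') - deriv Q (\<gamma> (of_real x)) * \<gamma>')
          = cnj e * ((deriv G z * a) * \<gamma>' - deriv Q (\<gamma> (of_real x)) * \<gamma>')" by (simp add: mult_ac)
        also have "\<dots> = (cnj e * e) * (of_real (k - x) * (\<gamma>' / \<gamma> (of_real x)))"
          unfolding 1 2 by (simp add: field_simps nz)
        finally show ?thesis by (simp add: ee)
      qed
      ultimately have "((\<lambda>X. Re (cnj e * (G (a * \<gamma> (of_real X)) - Q (\<gamma> (of_real X)))))
          has_real_derivative (k - x) * Re (\<gamma>' / \<gamma> (of_real x))) (at x)"
        by (simp only: Re_mult_of_real)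
      then have "((\<lambda>X. Re (cnj e * (G (a * \<gamma> (of_real X)) - Q (\<gamma> (of_real X)))) - \<epsilon> * X)
          has_real_derivative (k - x) * Re (\<gamma>' / \<gamma> (of_real x)) - \<epsilon>) (at x)"
        by (intro DERIV_diff DERIV_cmult_Id)
      moreover have "0 \<le> Re (\<gamma>' / \<gamma> (of_real x))"
      proof (rule ccontr)
        assume neg: "\<not> ?thesis"
        have "((\<lambda>X. Re (\<gamma> (of_real X) / \<gamma> (of_real x))) has_real_derivative Re (\<gamma>' / \<gamma> (of_real x))) (at x)"
          unfolding \<gamma>'_def
          by (rule has_field_derivative_Re[OF has_vector_derivative_real_field[OF
                DERIV_cdivide[OF d\<gamma>[OF x]]]])
        then obtain d where d: "d > 0" and inc: "\<And>y. 0 < y \<Longrightarrow> y < d \<Longrightarrow>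
            Re (\<gamma> (of_real x) / \<gamma> (of_real x)) < Re (\<gamma> (of_real (x - y)) / \<gamma> (of_real x))"
          using DERIV_neg_dec_left[OF _ neg[unfolded not_le]] by blast
        define y where "y = min (d / 2) x"
        have y: "0 < y" "y < d" "y \<le> x" using d x0 by (auto simp: y_def)
        have nz: "\<gamma> (of_real x) \<noteq> 0" using \<gamma>_nz x x0 by simp
        have "1 < Re (\<gamma> (of_real (x - y)) / \<gamma> (of_real x))"
          using inc[OF y(1,2)] nz by simp
        also have "\<dots> \<le> norm (\<gamma> (of_real (x - y)) / \<gamma> (of_real x))" by (rule complex_Re_le_cmod)
        also have "\<dots> < 1"
          using mono[of "x - y" x] y x nz by (simp add: norm_divide)
        finally show False .
      qed
      with \<open>k \<le> x\<close> have "(k - x) * Re (\<gamma>' / \<gamma> (of_real x)) \<le> 0"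
        by (intro mult_nonpos_nonneg) simp_all
      with \<epsilon> have "(k - x) * Re (\<gamma>' / \<gamma> (of_real x)) - \<epsilon> < 0" by linarith
      ultimately have "\<exists>d>0. \<forall>y>0. y < d \<longrightarrow> H (x, a) < H (x - y, a)"
        unfolding H_def fst_conv snd_conv by (rule DERIV_neg_dec_left)
      then obtain d where d: "d > 0" and inc: "\<And>y. 0 < y \<Longrightarrow> y < d \<Longrightarrow> H (x, a) < H (x - y, a)"
        by blast
      have "H (x, a) < H (x - min (d / 2) x, a)"
        using d x0 by (intro inc) auto
      moreover have "(x - min (d / 2) x, a) \<in> K"
        using x a d by (auto simp: K_def min_def)
      ultimately show False using p(2)[of "(x - min (d / 2) x, a)"] pxa by simp
    qed
    then have "H p = 0" using G Q \<gamma>0 by (simp add: pxa H_def)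
    moreover have "H (s, c) \<le> H p" using p(2)[of "(s, c)"] s c by (simp add: K_def)
    ultimately show ?thesis by (simp add: H_def \<gamma>s)
  qed
  have "Re (cnj e * (G (c * \<zeta>) - Q \<zeta>)) \<le> 0"
  proof (rule field_le_epsilon)
    fix \<epsilon> :: real assume "\<epsilon> > 0"
    then show "Re (cnj e * (G (c * \<zeta>) - Q \<zeta>)) \<le> 0 + \<epsilon>"
      using main[of "\<epsilon> / s"] s by simp
  qed
  then show ?thesis by (simp add: right_diff_distrib)
qed

text \<open>
  \<open>Q\<close> maps the disc into the set \<open>C\<close> of \<open>convex_closed_exp_halfplane_strip\<close>: its image is
  connected, contains the origin, and cannot cross the lines \<open>|Im w| = pi / 2\<close>, where \<open>Re (exp w) = 0\<close>.
  A value of \<open>G\<close> outside \<open>C\<close> would be strictly separated from \<open>C\<close> by a line, and the bound in the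
  direction normal to that line produces a value of \<open>Q\<close> on the wrong side.
\<close>
lemma Re_exp_ge_subordinate_integral:
  assumes \<delta>: "\<delta> > 0" "\<And>z. z \<in> \<D> \<Longrightarrow> \<delta> \<le> Re (exp (Q z))"
    and z: "z \<in> \<D>"
  shows "\<delta> \<le> Re (exp (G z))"
proof (rule ccontr)
  define C where "C = {w. \<bar>Im w\<bar> \<le> pi / 2 \<and> \<delta> \<le> Re (exp w)}"
  have QC: "Q y \<in> C" if y: "y \<in> \<D>" for y
  proof -
    have "\<bar>Im (Q y)\<bar> \<le> pi / 2"
    proof (rule ccontr)
      assume neg: "\<not> ?thesis"
      let ?A = "(\<lambda>z. \<bar>Im (Q z)\<bar>) ` \<D>"
      have "connected ?A"
        by (intro connected_continuous_image continuous_intros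
            holomorphic_on_imp_continuous_on[OF Q(1)]) simp
      moreover have "0 \<in> ?A" using Q(2) by (intro image_eqI[of _ _ 0]) auto
      moreover have "\<bar>Im (Q y)\<bar> \<in> ?A" using y by blast
      moreover have "0 \<le> pi / 2" "pi / 2 \<le> \<bar>Im (Q y)\<bar>" using neg by auto
      ultimately have "pi / 2 \<in> ?A"
        by (rule connectedD_interval)
      then obtain x where x: "pi / 2 = \<bar>Im (Q x)\<bar>" "x \<in> \<D>" by (rule imageE)
      from arg_cong[OF x(1), of cos] have "cos (Im (Q x)) = 0" by simp
      with \<delta>(1) \<delta>(2)[OF x(2)] show False by (simp add: Re_exp)
    qed
    with \<delta>(2)[OF y] show ?thesis by (simp add: C_def)
  qed
  assume "\<not> \<delta> \<le> Re (exp (G z))"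
  then have "G z \<notin> C" by (simp add: C_def)
  then obtain a b where ab: "inner a (G z) < b" "\<And>x. x \<in> C \<Longrightarrow> b < inner a x"
    using separating_hyperplane_closed_point[of C "G z"]
      convex_closed_exp_halfplane_strip[OF \<delta>(1)] unfolding C_def by blast
  have "a \<noteq> 0" using ab(1) ab(2)[OF QC[OF z]] by auto
  \<comment> \<open>\<open>C\<close> lies on the side to which \<open>a\<close> points, so \<open>G z\<close> sticks out in the opposite direction.\<close>
  define e where "e = - sgn a"
  have e: "norm e = 1" using \<open>a \<noteq> 0\<close> by (simp add: e_def norm_sgn)
  have ip: "inner a w = - norm a * Re (cnj e * w)" for w
  proof -
    have "a = - of_real (norm a) * e" using \<open>a \<noteq> 0\<close> by (simp add: e_def sgn_eq)
    then have "inner a w = inner (- of_real (norm a) * e) w" by simp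
    then show ?thesis by (simp add: inner_complex_def algebra_simps)
  qed
  obtain \<zeta> s where \<zeta>: "norm \<zeta> = norm z" "0 \<le> s" "h \<zeta> = of_real s * e"
    using circle_meets_ray[of "norm z" e] z e by auto
  have \<zeta>D: "\<zeta> \<in> \<D>" using \<zeta>(1) z by simp
  \<comment> \<open>If \<open>\<zeta> = 0\<close> then \<open>z = 0\<close> as well, and any unimodular factor will do.\<close>
  define c where "c = (if \<zeta> = 0 then 1 else z / \<zeta>)"
  have c: "norm c = 1" "c * \<zeta> = z" using \<zeta>(1) by (auto simp: c_def norm_divide)
  have "Re (cnj e * G z) \<le> Re (cnj e * Q \<zeta>)"
    using direction_bound_on_ray[OF e c(1) \<zeta>D \<zeta>(2,3)] c(2) by simp
  then have "inner a (Q \<zeta>) \<le> inner a (G z)"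
    unfolding ip by (simp add: mult_left_mono)
  with ab(1) ab(2)[OF QC[OF \<zeta>D]] show False by simp
qed

end

section \<open>Decay of the semigroup\<close>

text \<open>
  The flow satisfies \<open>d/ds |u|\<^sup>2 = - 2 * |u|\<^sup>2 * Re (p u) \<le> - 2 * \<delta> * |u|\<^sup>2\<close>, so
  \<open>|u|\<^sup>2 * exp (2 * \<delta> * s)\<close> is nonincreasing in \<open>s\<close>.
\<close>
lemma semigroup_exponential_decay:
  assumes f: "\<And>w. w \<in> \<D> \<Longrightarrow> f w = w * p w" and p: "\<And>w. w \<in> \<D> \<Longrightarrow> \<delta> \<le> Re (p w)"
    and u: "generated_semigroup f u" and t: "t \<ge> 0" and z: "z \<in> \<D>"
  shows "cmod (u t z) \<le> exp (- t * \<delta>) * cmod z"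
proof -
  define v where "v s = ((Re (u s z))\<^sup>2 + (Im (u s z))\<^sup>2) * exp (2 * \<delta> * s)" for s
  have uD: "u s z \<in> \<D>" if "s \<ge> 0" for s
    using u that z unfolding generated_semigroup_def by blast
  have ode: "((\<lambda>s. u s z) has_vector_derivative - f (u s z)) (at s within {0..})" if "s \<ge> 0" for s
    using u that z unfolding generated_semigroup_def by blast
  have "v t \<le> v 0"
  proof (rule DERIV_nonpos_imp_decreasing_open[OF t])
    fix s :: real assume s: "0 < s" "s < t"
    define w where "w = u s z"
    have "at s within {0..} = at s"
      using s by (intro at_within_interior) simp
    then have "((\<lambda>s. u s z) has_vector_derivative - f w) (at s)"
      using ode[of s] s by (simp only: w_def less_imp_le)
    note D = has_field_derivative_Re[OF this] has_field_derivative_Im[OF this]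
    have "(v has_real_derivative
        (2 * Re w * Re (- f w) + 2 * Im w * Im (- f w)) * exp (2 * \<delta> * s)
        + ((Re w)\<^sup>2 + (Im w)\<^sup>2) * (2 * \<delta> * exp (2 * \<delta> * s))) (at s)"
      unfolding v_def
      by (rule derivative_eq_intros D refl | simp add: w_def)+
    moreover have "(2 * Re w * Re (- f w) + 2 * Im w * Im (- f w)) * exp (2 * \<delta> * s)
        + ((Re w)\<^sup>2 + (Im w)\<^sup>2) * (2 * \<delta> * exp (2 * \<delta> * s))
        = 2 * ((Re w)\<^sup>2 + (Im w)\<^sup>2) * (\<delta> - Re (p w)) * exp (2 * \<delta> * s)"
      using f[OF uD[of s]] s by (simp add: w_def algebra_simps power2_eq_square)
    moreover have "\<dots> \<le> 0"
      using p[OF uD[of s]] s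
      by (intro mult_nonpos_nonneg mult_nonneg_nonpos) (auto simp: w_def)
    ultimately show "\<exists>y. (v has_real_derivative y) (at s) \<and> y \<le> 0" by auto
  next
    have "continuous_on {0..} (\<lambda>s. u s z)"
      unfolding continuous_on_eq_continuous_within
      using has_vector_derivative_continuous[OF ode] by simp
    then have "continuous_on {0..t} (\<lambda>s. u s z)"
      by (rule continuous_on_subset) auto
    then show "continuous_on {0..t} v"
      unfolding v_def by (intro continuous_intros)
  qed
  moreover have "u 0 z = z" using u z unfolding generated_semigroup_def by blast
  ultimately have "(cmod (u t z))\<^sup>2 * exp (2 * \<delta> * t) \<le> (cmod z)\<^sup>2"
    by (simp add: v_def cmod_power2)
  then have "(cmod (u t z) * exp (\<delta> * t))\<^sup>2 \<le> (cmod z)\<^sup>2"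
    by (simp add: power_mult_distrib exp_double[symmetric] mult_ac)
  then have "cmod (u t z) * exp (\<delta> * t) \<le> cmod z"
    by (rule power2_le_imp_le) simp
  then show ?thesis
    by (simp add: exp_minus field_simps)
qed

section \<open>The inclusion and the decay estimate\<close>

theorem theorem3p1:
  fixes \<Psi> :: "complex \<Rightarrow> complex" and \<delta> :: real
  assumes "convex_function \<Psi>" and "\<Psi> 0 = 0"
    and "\<delta> > 0"
    and "\<And>z. z \<in> \<D> \<Longrightarrow> Re (exp (contour_integral (linepath 0 z) (\<lambda>t. \<Psi> t / t))) \<ge> \<delta>"
  shows "\<F> \<Psi> \<subseteq> \<G>\<^sub>0 \<and>
    (\<forall>f\<in>\<F> \<Psi>. \<forall>u. generated_semigroup f u \<longrightarrow>
       (\<forall>t\<ge>0. \<forall>z\<in>\<D>. cmod (u t z) \<le> exp (- t * \<delta>) * cmod z))"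
proof -
  have hol: "\<Psi> holomorphic_on \<D>" and inj: "inj_on \<Psi> \<D>" and cvx: "convex (\<Psi> ` \<D>)"
    using assms(1) by (auto simp: convex_function_def univalent_def)
  have star: "of_real t * \<Psi> z \<in> \<Psi> ` \<D>" if "z \<in> \<D>" "0 \<le> t" "t \<le> 1" for z t
  proof -
    have "0 \<in> \<Psi> ` \<D>" using assms(2) by (force intro: image_eqI[of _ _ 0])
    then have "(1 - t) *\<^sub>R 0 + t *\<^sub>R \<Psi> z \<in> \<Psi> ` \<D>"
      using that by (intro convexD_alt[OF cvx]) auto
    then show ?thesis by (simp add: scaleR_conv_of_real)
  qed
  obtain q where q: "q holomorphic_on \<D>" "\<And>z. norm z < 1 \<Longrightarrow> \<Psi> z = z * q z"
    using Schwarz3[OF hol assms(2)] by blast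
  obtain Q1 where Q1: "\<And>z. z \<in> \<D> \<Longrightarrow> (Q1 has_field_derivative q z) (at z within \<D>)"
    using holomorphic_convex_primitive'[OF convex_ball open_ball q(1)] by blast
  define Q where "Q z = Q1 z - Q1 0" for z
  have dQ: "(Q has_field_derivative q z) (at z)" if "z \<in> \<D>" for z
    using Q1[OF that] that unfolding Q_def
    by (auto intro!: derivative_eq_intros simp: at_within_open[OF _ open_ball])
  have Q: "Q holomorphic_on \<D>" "Q 0 = 0" "\<And>z. z \<in> \<D> \<Longrightarrow> z * deriv Q z = \<Psi> z"
    using dQ holomorphic_on_open[OF open_ball] q(2) DERIV_imp_deriv[OF dQ]
    by (blast, simp_all add: Q_def)
  have int: "contour_integral (linepath 0 z) (\<lambda>t. \<Psi> t / t) = Q z" if z: "z \<in> \<D>" for z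
  proof (cases "z = 0")
    case True
    then show ?thesis by (simp add: Q)
  next
    case False
    have seg: "closed_segment 0 z \<subseteq> \<D>" using z by (intro closed_segment_subset) auto
    have prim: "(q has_contour_integral (Q (pathfinish (linepath 0 z)) - Q (pathstart (linepath 0 z))))
        (linepath 0 z)"
      by (rule contour_integral_primitive[of \<D>, OF has_field_derivative_at_within[OF dQ]])
        (simp_all only: valid_path_linepath path_image_linepath seg)
    have "contour_integral (linepath 0 z) (\<lambda>t. \<Psi> t / t) = contour_integral (linepath 0 z) q"
      using False seg q(2)
      by (intro contour_integral_spike_finite_simple_path[of "{0}"]) auto
    also have "\<dots> = Q z"
      using contour_integral_unique[OF prim] by (simp add: Q)
    finally show ?thesis .
  qed
  have Q\<delta>: "\<delta> \<le> Re (exp (Q z))" if "z \<in> \<D>" for z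
    using assms(4)[OF that] int[OF that] by simp
  have factor: "\<exists>p. p holomorphic_on \<D> \<and> (\<forall>z\<in>\<D>. f z = z * p z \<and> \<delta> \<le> Re (p z))"
    if fF: "f \<in> \<F> \<Psi>" for f
  proof -
    from fF have f: "f holomorphic_on \<D>" "f 0 = 0" "deriv f 0 = 1"
      and fnz: "\<And>z. z \<in> \<D> \<Longrightarrow> z \<noteq> 0 \<Longrightarrow> f z \<noteq> 0"
      and "log_deriv_shift f \<prec>\<^sub>D \<Psi>"
      by (auto simp: class_F_def class_A_def)
    then obtain \<omega> where \<omega>: "\<omega> holomorphic_on \<D>" "\<omega> ` \<D> \<subseteq> \<D>" "\<omega> 0 = 0"
      and \<omega>_eq: "\<And>z. z \<in> \<D> \<Longrightarrow> log_deriv_shift f z = \<Psi> (\<omega> z)"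
      unfolding subordinate_def by blast
    have \<omega>_le: "norm (\<omega> z) \<le> norm z" if "z \<in> \<D>" for z
      using Schwarz_Lemma(1)[OF \<omega>(1,3), of z] \<omega>(2) that by (auto simp: image_subset_iff)
    obtain p where p: "p holomorphic_on \<D>" "\<And>z. norm z < 1 \<Longrightarrow> f z = z * p z" "p 0 = 1"
      using Schwarz3[OF f(1,2)] f(3) by metis
    have "p z \<noteq> 0" if "z \<in> \<D>" for z
      using p(2)[of z] p(3) fnz[OF that] that by (cases "z = 0") auto
    then obtain L where L: "L holomorphic_on \<D>" "\<And>z. z \<in> \<D> \<Longrightarrow> exp (L z) = p z"
      using holomorphic_logarithm_exists[OF convex_ball open_ball p(1), of 0] by auto
    define G where "G z = L z - L 0" for z
    have G: "G holomorphic_on \<D>" "G 0 = 0"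
      using L(1) by (auto simp: G_def[abs_def] intro!: holomorphic_intros)
    have expG: "exp (G z) = p z" if "z \<in> \<D>" for z
      using L(2)[OF that] L(2)[of 0] p(3) by (simp add: G_def exp_diff)
    have "z * deriv G z = \<Psi> (\<omega> z)" if z: "z \<in> \<D>" for z
    proof (cases "z = 0")
      case True
      then show ?thesis by (simp add: \<omega> assms)
    next
      case False
      have "((\<lambda>z. z * exp (G z)) has_field_derivative
          exp (G z) + z * (exp (G z) * deriv G z)) (at z)"
        using holomorphic_derivI[OF G(1) open_ball z]
        by (auto intro!: derivative_eq_intros)
      then have "(f has_field_derivative exp (G z) + z * (exp (G z) * deriv G z)) (at z)"
        by (rule has_field_derivative_transform_within_open[of _ _ _ \<D>])
          (use z expG p(2) in auto)
      then have "deriv f z = exp (G z) + z * (exp (G z) * deriv G z)"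
        by (rule DERIV_imp_deriv)
      moreover have "f z = z * exp (G z)" using p(2)[of z] expG[OF z] z by simp
      ultimately have "log_deriv_shift f z = z * deriv G z"
        using False by (simp add: log_deriv_shift_def field_simps)
      with \<omega>_eq[OF z] show ?thesis by simp
    qed
    with G have subint: "subordinate_integrals \<Psi> \<omega> G Q"
      using hol inj assms(2) star \<omega>_le Q by unfold_locales auto
    have "\<delta> \<le> Re (p z)" if "z \<in> \<D>" for z
      using subordinate_integrals.Re_exp_ge_subordinate_integral[OF _ assms(3) Q\<delta> that, of \<Psi> \<omega> G]
        expG[OF that] subint by simp
    with p show ?thesis by (intro exI[of _ p]) auto
  qed
  show ?thesis
  proof (intro conjI ballI allI impI subsetI)
    fix f assume fF: "f \<in> \<F> \<Psi>"
    then have "f \<in> \<A>" by (simp add: class_F_def)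
    with factor[OF fF] assms(3) show "f \<in> \<G>\<^sub>0"
      by (fastforce simp: class_G0_def)
  next
    fix f u t z
    assume "f \<in> \<F> \<Psi>" "generated_semigroup f u" "(t::real) \<ge> 0" "z \<in> \<D>"
    then show "cmod (u t z) \<le> exp (- t * \<delta>) * cmod z"
      using factor[of f] semigroup_exponential_decay[of f _ \<delta> u t z] by blast
  qed
qed

end
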